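(* Let $T$ be an uncertainty polynomial functor, $D$ a Lindenbaum $T$-deduction system, $\Delta_{Ps}S\in\mathsf{Ing}\,T$ and $x\in X_{\Delta_{Ps}S}$. For $\varphi::S$ put $\pi_x(|\varphi|_S)=\sup\{q\in[0,1]:\mathsf{Ps}_{\ge q}\varphi\in x\}$. Then $\pi_x$ is a well-defined (depending only on $|\varphi|_S$) possibility measure on $(X_S,\Sigma_S)$.
   Context: Uncertainty spaces. An uncertainty space is $(X,\Sigma)$ with $\Sigma$ an algebra of subsets of $X$ (nonempty, closed under finite unions and complements $U^c=X\setminus U$). A (finitely additive) probability measure is $\mu:\Sigma\to[0,1]$ with $\mu(\emptyset)=0$, $\mu(X)=1$, $\mu(U\cup V)=\mu(U)+\mu(V)$ for disjoint $U,V$. An upper probability measure is $g(U)=\sup_{\mu\in\mathcal P}\mu(U)$ for a nonempty set $\mathcal P$ of probability measures. A plausibility measure is $\gamma:\Sigma\to[0,1]$ with $\gamma(\emptyset)=0$, $\gamma(X)=1$, $\gamma(U_1\cap\dots\cap U_n)\le\sum_{\emptyset\ne I\subseteq J_n}(-1)^{|I|+1}\gamma(\bigcup_{i\in I}U_i)$ ($n\ge1$, $J_n=\{1,\dots,n\}$). A possibility measure is $\pi:\Sigma\to[0,1]$ with $\pi(\emptyset)=0$, $\pi(X)=1$, $\pi(U\cup V)=\max\{\pi(U),\pi(V)\}$ for all $U,V\in\Sigma$. $\Delta^*X,\Delta X,\Delta_{Pl}X,\Delta_{Ps}X$ are the sets of these four kinds of measures, with algebras generated by $\beta^{p,q}(U)=\{g:g(U)\ge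 p,1-g(U^c)\ge q\}$, $\beta^p_{pr}(U)=\{\mu:\mu(U)\ge p\}$, $\beta^{p,q}_{Pl}(U)$, $\beta^{p,q}_{Ps}(U)$ (defined like $\beta^{p,q}$). Products, coproducts and constant functors (with space $(M,\Sigma_M)$) as usual. Uncertainty polynomial functors: smallest class of endofunctors containing $Id$ and constants, closed under pointwise $\times$, $+$ and composition with $\Delta^*,\Delta,\Delta_{Pl},\Delta_{Ps}$. Language. $\mathsf{Ing}\,T$: $\mathsf{Ing}\,Id=\{Id\}$, $\mathsf{Ing}\,M=\{M,Id\}$, $\mathsf{Ing}(T_1\times T_2)=\{T_1\times T_2\}\cup\mathsf{Ing}\,T_1\cup\mathsf{Ing}\,T_2$, same for $+$, $\mathsf{Ing}\,US=\{US\}\cup\mathsf{Ing}\,S$ for $U\in\{\Delta^*,\Delta,\Delta_{Pl},\Delta_{Ps}\}$. Formulas of sort $S$ ($\mathsf{Form}_S$): $\bot_S$; $\varphi\to\psi$; $A:M$ for $A\in\Sigma_M$ or $A=\{m\}$; $[\mathsf{pr}_j]\varphi:S_1\times S_2$ ($\varphi:S_j$); $[\mathsf{in}_j]\varphi:S_1+S_2$ ($\varphi:S_j$); $[\mathsf{next}]\varphi:Id$ ($\varphi:T$); for $\varphi::S$ (all constant subformulas in $\Sigma_M$) and $p,q\in[0,1]$: $[(p,q)]\varphi:\Delta^*S$, $\mathsf P_{\ge p}\varphi:\Delta S$, $[(p,q)]_{Pl}\varphi:\Delta_{Pl}S$, $[(p,q)]_{Ps}\varphi:\Delta_{Ps}S$.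 Non-probabilistic labels $\kappa\in\{\mathsf{pr}_j,\mathsf{in}_j,\mathsf{next}\}$. Abbreviations: $\neg,\vee,\wedge,\leftrightarrow,\top_S$; $\mathsf U_{\ge p}=[(p,0)]$, $\mathsf L_{\ge p}=[(0,p)]$, $\mathsf U_{\le p}\varphi=[(0,1-p)]\neg\varphi$, $\mathsf U_{<p}=\neg\mathsf U_{\ge p}$; $\mathsf P_{<p}\varphi=\neg\mathsf P_{\ge p}\varphi$, $\mathsf P_{\le p}\varphi=\mathsf P_{\ge1-p}\neg\varphi$; $\mathsf{Pl}_{\ge p}=[(p,0)]_{Pl}$, $\mathsf{Bel}_{\ge p}=[(0,p)]_{Pl}$, $\mathsf{Pl}_{\le p}\varphi=[(0,1-p)]_{Pl}\neg\varphi$, $\mathsf{Bel}_{\le p}\varphi=[(1-p,0)]_{Pl}\neg\varphi$, $\mathsf{Pl}_{<p}=\neg\mathsf{Pl}_{\ge p}$, $\mathsf{Bel}_{<p}=\neg\mathsf{Bel}_{\ge p}$; $\mathsf{Ps}_{\ge p}=[(p,0)]_{Ps}$, $\mathsf N_{\ge p}=[(0,p)]_{Ps}$, $\mathsf{Ps}_{\le p}\varphi=[(0,1-p)]_{Ps}\neg\varphi$, $\mathsf N_{\le p}\varphi=[(1-p,0)]_{Ps}\neg\varphi$, $\mathsf{Ps}_{<p}=\neg\mathsf{Ps}_{\ge p}$, $\mathsf N_{<p}=\neg\mathsf N_{\ge p}$. $\mathsf{Pl}_{[i]p}$ is $\mathsf{Pl}_{\le p}$ for odd $i$, $\mathsf{Pl}_{\ge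 p}$ for even $i$; $\psi_I=\bigvee_{i\in I}\varphi_i$. Axioms $Ax_S$ ($\varphi,\psi::S'$ in measure cases): Boolean tautologies; $\{c\}\to A$ ($c\in A$), $\{c\}\to\neg A$ ($c\notin A$); $\neg[\kappa]\varphi\to[\kappa]\neg\varphi$; $\neg[\mathsf{pr}_j]\bot$; $\neg[\mathsf{in}_1]\bot_{S_1}\leftrightarrow[\mathsf{in}_2]\bot_{S_2}$; $\neg[\mathsf{next}]\bot_T$. $\Delta^*S'$: $\mathsf U_{\le p}\varphi\to\mathsf U_{<q}\varphi$ ($p<q$); $\mathsf U_{<p}\varphi\to\mathsf U_{\le p}\varphi$; $\mathsf L_{\ge1}(\varphi\to\psi)\to(\mathsf U_{\ge p}\varphi\to\mathsf U_{\ge p}\psi)$; $[(p,q)]\varphi\leftrightarrow(\mathsf U_{\ge p}\varphi\wedge\mathsf L_{\ge q}\varphi)$. $\Delta S'$: $\mathsf P_{\le p}\varphi\to\mathsf P_{<q}\varphi$ ($p<q$); $\mathsf P_{<p}\varphi\to\mathsf P_{\le p}\varphi$; $\mathsf P_{\ge1}(\varphi\to\psi)\to(\mathsf P_{\ge p}\varphi\to\mathsf P_{\ge p}\psi)$. $\Delta_{Pl}S'$: $\mathsf{Pl}_{\le p}\varphi\to\mathsf{Pl}_{<q}\varphi$ ($p<q$); $\mathsf{Pl}_{<p}\varphi\to\mathsf{Pl}_{\le p}\varphi$; $\mathsf{Pl}_{\le p}\varphi\to\mathsf{Bel}_{\le p}\varphi$; $\mathsf{Bel}_{\ge1}(\varphi\to\psi)\to(\mathsf{Pl}_{\ge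 p}\varphi\to\mathsf{Pl}_{\ge p}\psi)$; $[(p,q)]_{Pl}\varphi\leftrightarrow(\mathsf{Pl}_{\ge p}\varphi\wedge\mathsf{Bel}_{\ge q}\varphi)$; for $\varphi_1,\dots,\varphi_n::S'$, $p_I\in[0,1]$ ($\emptyset\ne I\subseteq J_n$), $q=\sum_I(-1)^{|I|+1}p_I$: if $q\ge0$, $p=\min(q,1)$: $(\bigwedge_I\mathsf{Pl}_{[|I|]p_I}\psi_I)\to\mathsf{Pl}_{\le p}(\bigwedge_i\varphi_i)$; if $q<0$: $\neg\bigwedge_I\mathsf{Pl}_{[|I|]p_I}\psi_I$. $\Delta_{Ps}S'$: $\mathsf{Ps}_{\le p}\varphi\to\mathsf{Ps}_{<q}\varphi$ ($p<q$); $\mathsf{Ps}_{<p}\varphi\to\mathsf{Ps}_{\le p}\varphi$; $\mathsf{Ps}_{\le0}\bot_{S'}$; $\mathsf{Ps}_{\le p}\varphi\to\mathsf N_{\le p}\varphi$; $(\mathsf{Ps}_{\le p}\varphi\wedge\mathsf{Ps}_{\le q}\psi)\to\mathsf{Ps}_{\le\max(p,q)}(\varphi\vee\psi)$; $\mathsf N_{\ge1}(\varphi\to\psi)\to(\mathsf{Ps}_{\ge p}\varphi\to\mathsf{Ps}_{\ge p}\psi)$; $[(p,q)]_{Ps}\varphi\leftrightarrow(\mathsf{Ps}_{\ge p}\varphi\wedge\mathsf N_{\ge q}\varphi)$. A $T$-deduction system is a family $\vdash_S\subseteq\mathcal P(\mathsf{Form}_S)\times\mathsf{Form}_S$ ($\vdash_S\varphi$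 means $\emptyset\vdash_S\varphi$) satisfying: Assumption ($\varphi\in\Gamma\cup Ax_S\Rightarrow\Gamma\vdash_S\varphi$); Modus ponens $\{\varphi,\varphi\to\psi\}\vdash_S\psi$; Cut (if $\Gamma\vdash_S\psi$ for all $\psi\in\Lambda$ and $\Lambda\vdash_S\varphi$ then $\Gamma\vdash_S\varphi$); Deduction; Constant ($\{\neg\{c\}:c\in M\}\vdash_M\bot_M$); Definite box ($\Gamma\vdash_{S'}\psi\Rightarrow[\kappa]\Gamma\vdash_S[\kappa]\psi$); Necessitation (for $\varphi::S$, $\vdash_S\varphi$ implies $\vdash_{\Delta^*S}\mathsf L_{\ge1}\varphi$, $\vdash_{\Delta S}\mathsf P_{\ge1}\varphi$, $\vdash_{\Delta_{Pl}S}\mathsf{Bel}_{\ge1}\varphi$, $\vdash_{\Delta_{Ps}S}\mathsf N_{\ge1}\varphi$ when these sorts are ingredients); Archimedean ($\{\mathsf O_{\ge q}\psi:q<p\}\vdash\mathsf O_{\ge p}\psi$ for $\mathsf O\in\{\mathsf U,\mathsf L,\mathsf P,\mathsf{Pl},\mathsf{Bel},\mathsf{Ps},\mathsf N\}$); Cover rules for $\mathsf O\in\{\mathsf U,\mathsf P\}$ at sorts $\Delta^*S$, resp. $\Delta S$, with $\varphi,\varphi_i::S$, $k\ge0$: (C1) if $n\ge1$, $\vdash_S\varphi\to\bigvee_{I\subseteq J_m,|I|=n+k}\bigwedge_{i\in I}\varphi_i$, $\vdash_S\bigvee_{I\subseteq J_m,|I|=k}\bigwedge_{i\in I}\varphi_i$,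 $p_i\in[0,1]$, $p=\max(0,\min(1,(\sum p_i-k)/n))$, then $\vdash(\bigwedge_i\mathsf O_{\le p_i}\varphi_i)\to\mathsf O_{\le p}\varphi$; (C2) if $\vdash_S\bigvee_{I\subseteq J_m,|I|=k}\bigwedge_{i\in I}\varphi_i$ and $\sum p_i<k$, then $\vdash\neg\bigwedge_i\mathsf O_{\le p_i}\varphi_i$. $\Gamma$ is $\vdash_S$-consistent if $\Gamma\not\vdash_S\bot_S$; $\vdash_S$-maximal if consistent and negation complete ($\varphi\in\Gamma$ iff $\neg\varphi\notin\Gamma$). $D$ is Lindenbaum if every consistent set extends to a maximal one. $X_S$ = set of $\vdash_S$-maximal sets, $|\varphi|_S=\{y\in X_S:\varphi\in y\}$, $\Sigma_S=\{|\varphi|_S:\varphi::S\}$. *)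

theory Defs
  imports Complex_Main "HOL-Analysis.Sigma_Algebra"
begin

section \<open>Uncertainty spaces and possibility measures\<close>

text \<open>An uncertainty space is a pair satisfying \<^const>\<open>algebra\<close>.\<close>

definition possibility_measure :: "'a set \<Rightarrow> 'a set set \<Rightarrow> ('a set \<Rightarrow> real) \<Rightarrow> bool" where
  "possibility_measure X \<Sigma> \<pi> \<longleftrightarrow>
     algebra X \<Sigma> \<and>
     (\<forall>U\<in>\<Sigma>. 0 \<le> \<pi> U \<and> \<pi> U \<le> 1) \<and>
     \<pi> {} = 0 \<and> \<pi> X = 1 \<and>
     (\<forall>U\<in>\<Sigma>. \<forall>V\<in>\<Sigma>. \<pi> (U \<union> V) = max (\<pi> U) (\<pi> V))"


section \<open>Uncertainty polynomial functors and their ingredients\<close>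

text \<open>
  A functor is given by the expression that builds it; ingredients, formulas and deduction
  systems are all defined by recursion on that expression and never on the action of the functor.
  Since only finitely many constant spaces \<open>(M, \<Sigma>\<^sub>M)\<close> occur in a functor, all their carriers may
  be taken to be subsets of one arbitrary type \<open>'m\<close>.
\<close>

datatype 'm upf =
    IdF
  | ConstF "'m set" "'m set set"
  | ProdF "'m upf" "'m upf"
  | SumF "'m upf" "'m upf"
  | UpperF "'m upf"  \<comment> \<open>\<open>\<Delta>\<^sup>*\<close>\<close>
  | ProbF "'m upf"   \<comment> \<open>\<open>\<Delta>\<close>\<close>
  | PlausF "'m upf"  \<comment> \<open>\<open>\<Delta>\<^sub>P\<^sub>l\<close>\<close>
  | PossF "'m upf"   \<comment> \<open>\<open>\<Delta>\<^sub>P\<^sub>s\<close>\<close>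

primrec uncertainty_polynomial :: "'m upf \<Rightarrow> bool" where
  "uncertainty_polynomial IdF \<longleftrightarrow> True"
| "uncertainty_polynomial (ConstF M \<Sigma>) \<longleftrightarrow> algebra M \<Sigma>"
| "uncertainty_polynomial (ProdF S1 S2) \<longleftrightarrow> uncertainty_polynomial S1 \<and> uncertainty_polynomial S2"
| "uncertainty_polynomial (SumF S1 S2) \<longleftrightarrow> uncertainty_polynomial S1 \<and> uncertainty_polynomial S2"
| "uncertainty_polynomial (UpperF S) \<longleftrightarrow> uncertainty_polynomial S"
| "uncertainty_polynomial (ProbF S) \<longleftrightarrow> uncertainty_polynomial S"
| "uncertainty_polynomial (PlausF S) \<longleftrightarrow> uncertainty_polynomial S"
| "uncertainty_polynomial (PossF S) \<longleftrightarrow> uncertainty_polynomial S"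

primrec Ing :: "'m upf \<Rightarrow> 'm upf set" where
  "Ing IdF = {IdF}"
| "Ing (ConstF M \<Sigma>) = {ConstF M \<Sigma>, IdF}"
| "Ing (ProdF S1 S2) = {ProdF S1 S2} \<union> Ing S1 \<union> Ing S2"
| "Ing (SumF S1 S2) = {SumF S1 S2} \<union> Ing S1 \<union> Ing S2"
| "Ing (UpperF S) = {UpperF S} \<union> Ing S"
| "Ing (ProbF S) = {ProbF S} \<union> Ing S"
| "Ing (PlausF S) = {PlausF S} \<union> Ing S"
| "Ing (PossF S) = {PossF S} \<union> Ing S"


section \<open>Formulas\<close>

datatype label = Pr1 | Pr2 | In1 | In2 | Next

text \<open>
  Raw formulas carry no sort annotations: once the sort of a formula is fixed, the sorts of all
  its subformulas are determined, so each \<open>\<bottom>\<^sub>S\<close> can be written as the same symbol.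
\<close>

datatype 'm form =
    Bot  (\<open>\<^bold>\<bottom>\<close>)
  | Imp "'m form" "'m form"  (infixr \<open>\<^bold>\<longrightarrow>\<close> 25)
  | Cst "'m set"
  | Box label "'m form"
  | UL real real "'m form"   \<comment> \<open>\<open>[(p,q)]\<close>\<close>
  | P_ge real "'m form"
  | PlB real real "'m form"  \<comment> \<open>\<open>[(p,q)]\<^sub>P\<^sub>l\<close>\<close>
  | PsN real real "'m form"  \<comment> \<open>\<open>[(p,q)]\<^sub>P\<^sub>s\<close>\<close>

text \<open>\<open>step T \<kappa> S S'\<close>: the box \<open>[\<kappa>]\<close> turns formulas of sort \<open>S'\<close> into formulas of sort \<open>S\<close>.\<close>

fun step :: "'m upf \<Rightarrow> label \<Rightarrow> 'm upf \<Rightarrow> 'm upf \<Rightarrow> bool" where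
  "step T Pr1 S S' \<longleftrightarrow> (\<exists>S2. S = ProdF S' S2)"
| "step T Pr2 S S' \<longleftrightarrow> (\<exists>S1. S = ProdF S1 S')"
| "step T In1 S S' \<longleftrightarrow> (\<exists>S2. S = SumF S' S2)"
| "step T In2 S S' \<longleftrightarrow> (\<exists>S1. S = SumF S1 S')"
| "step T Next S S' \<longleftrightarrow> S = IdF \<and> S' = T"

text \<open>
  For a formula \<open>\<phi>\<close> of sort \<open>S\<close>, \<open>measurable_consts T \<phi> S\<close> says that every constant subformula
  of \<open>\<phi>\<close>, say of sort \<open>M\<close>, belongs to \<open>\<Sigma>\<^sub>M\<close>.
\<close>

primrec measurable_consts :: "'m upf \<Rightarrow> 'm form \<Rightarrow> 'm upf \<Rightarrow> bool" where
  "measurable_consts T \<^bold>\<bottom> S \<longleftrightarrow> True"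
| "measurable_consts T (\<phi> \<^bold>\<longrightarrow> \<psi>) S \<longleftrightarrow> measurable_consts T \<phi> S \<and> measurable_consts T \<psi> S"
| "measurable_consts T (Cst A) S \<longleftrightarrow> (\<exists>M \<Sigma>. S = ConstF M \<Sigma> \<and> A \<in> \<Sigma>)"
| "measurable_consts T (Box \<kappa> \<phi>) S \<longleftrightarrow> (\<exists>S'. step T \<kappa> S S' \<and> measurable_consts T \<phi> S')"
| "measurable_consts T (UL p q \<phi>) S \<longleftrightarrow> (\<exists>S'. S = UpperF S' \<and> measurable_consts T \<phi> S')"
| "measurable_consts T (P_ge p \<phi>) S \<longleftrightarrow> (\<exists>S'. S = ProbF S' \<and> measurable_consts T \<phi> S')"
| "measurable_consts T (PlB p q \<phi>) S \<longleftrightarrow> (\<exists>S'. S = PlausF S' \<and> measurable_consts T \<phi> S')"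
| "measurable_consts T (PsN p q \<phi>) S \<longleftrightarrow> (\<exists>S'. S = PossF S' \<and> measurable_consts T \<phi> S')"

text \<open>\<open>has_sort T \<phi> S\<close> is \<open>\<phi> : S\<close>.\<close>

primrec has_sort :: "'m upf \<Rightarrow> 'm form \<Rightarrow> 'm upf \<Rightarrow> bool" where
  "has_sort T \<^bold>\<bottom> S \<longleftrightarrow> True"
| "has_sort T (\<phi> \<^bold>\<longrightarrow> \<psi>) S \<longleftrightarrow> has_sort T \<phi> S \<and> has_sort T \<psi> S"
| "has_sort T (Cst A) S \<longleftrightarrow>
     (\<exists>M \<Sigma>. S = ConstF M \<Sigma> \<and> (A \<in> \<Sigma> \<or> (\<exists>m\<in>M. A = {m})))"
| "has_sort T (Box \<kappa> \<phi>) S \<longleftrightarrow> (\<exists>S'. step T \<kappa> S S' \<and> has_sort T \<phi> S')"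
| "has_sort T (UL p q \<phi>) S \<longleftrightarrow>
     p \<in> {0..1} \<and> q \<in> {0..1} \<and>
     (\<exists>S'. S = UpperF S' \<and> has_sort T \<phi> S' \<and> measurable_consts T \<phi> S')"
| "has_sort T (P_ge p \<phi>) S \<longleftrightarrow>
     p \<in> {0..1} \<and>
     (\<exists>S'. S = ProbF S' \<and> has_sort T \<phi> S' \<and> measurable_consts T \<phi> S')"
| "has_sort T (PlB p q \<phi>) S \<longleftrightarrow>
     p \<in> {0..1} \<and> q \<in> {0..1} \<and>
     (\<exists>S'. S = PlausF S' \<and> has_sort T \<phi> S' \<and> measurable_consts T \<phi> S')"
| "has_sort T (PsN p q \<phi>) S \<longleftrightarrow>
     p \<in> {0..1} \<and> q \<in> {0..1} \<and>
     (\<exists>S'. S = PossF S' \<and> has_sort T \<phi> S' \<and> measurable_consts T \<phi> S')"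

definition Form :: "'m upf \<Rightarrow> 'm upf \<Rightarrow> 'm form set" where
  "Form T S = {\<phi>. has_sort T \<phi> S}"

text \<open>The formulas \<open>\<phi> :: S\<close>.\<close>

definition MForm :: "'m upf \<Rightarrow> 'm upf \<Rightarrow> 'm form set" where
  "MForm T S = {\<phi>. has_sort T \<phi> S \<and> measurable_consts T \<phi> S}"


section \<open>Abbreviations\<close>

abbreviation Neg :: "'m form \<Rightarrow> 'm form"  (\<open>\<^bold>\<not> _\<close> [40] 40) where
  "\<^bold>\<not> \<phi> \<equiv> (\<phi> \<^bold>\<longrightarrow> \<^bold>\<bottom>)"

abbreviation Top :: "'m form"  (\<open>\<^bold>\<top>\<close>) where
  "\<^bold>\<top> \<equiv> \<^bold>\<not> \<^bold>\<bottom>"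

abbreviation Or :: "'m form \<Rightarrow> 'm form \<Rightarrow> 'm form"  (infixr \<open>\<^bold>\<or>\<close> 30) where
  "\<phi> \<^bold>\<or> \<psi> \<equiv> (\<^bold>\<not> \<phi>) \<^bold>\<longrightarrow> \<psi>"

abbreviation And :: "'m form \<Rightarrow> 'm form \<Rightarrow> 'm form"  (infixr \<open>\<^bold>\<and>\<close> 35) where
  "\<phi> \<^bold>\<and> \<psi> \<equiv> \<^bold>\<not> (\<phi> \<^bold>\<longrightarrow> \<^bold>\<not> \<psi>)"

abbreviation Iff :: "'m form \<Rightarrow> 'm form \<Rightarrow> 'm form"  (infixr \<open>\<^bold>\<longleftrightarrow>\<close> 25) where
  "\<phi> \<^bold>\<longleftrightarrow> \<psi> \<equiv> (\<phi> \<^bold>\<longrightarrow> \<psi>) \<^bold>\<and> (\<psi> \<^bold>\<longrightarrow> \<phi>)"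

fun Conjs :: "'m form list \<Rightarrow> 'm form" where
  "Conjs [] = \<^bold>\<top>"
| "Conjs [\<phi>] = \<phi>"
| "Conjs (\<phi> # \<psi> # \<Phi>) = (\<phi> \<^bold>\<and> Conjs (\<psi> # \<Phi>))"

fun Disjs :: "'m form list \<Rightarrow> 'm form" where
  "Disjs [] = \<^bold>\<bottom>"
| "Disjs [\<phi>] = \<phi>"
| "Disjs (\<phi> # \<psi> # \<Phi>) = (\<phi> \<^bold>\<or> Disjs (\<psi> # \<Phi>))"

text \<open>
  Conjunctions and disjunctions over a finite index set are formed along some fixed enumeration of
  that set; different enumerations give provably equivalent formulas.
\<close>

definition enum_of :: "'i set \<Rightarrow> 'i list" where
  "enum_of A = (SOME is. distinct is \<and> set is = A)"

definition BigAnd :: "'i set \<Rightarrow> ('i \<Rightarrow> 'm form) \<Rightarrow> 'm form" where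
  "BigAnd A f = Conjs (map f (enum_of A))"

definition BigOr :: "'i set \<Rightarrow> ('i \<Rightarrow> 'm form) \<Rightarrow> 'm form" where
  "BigOr A f = Disjs (map f (enum_of A))"

abbreviation U_ge where "U_ge p \<phi> \<equiv> UL p 0 \<phi>"
abbreviation L_ge where "L_ge p \<phi> \<equiv> UL 0 p \<phi>"
abbreviation U_le where "U_le p \<phi> \<equiv> UL 0 (1 - p) (\<^bold>\<not> \<phi>)"
abbreviation U_lt where "U_lt p \<phi> \<equiv> \<^bold>\<not> U_ge p \<phi>"

abbreviation P_lt where "P_lt p \<phi> \<equiv> \<^bold>\<not> P_ge p \<phi>"
abbreviation P_le where "P_le p \<phi> \<equiv> P_ge (1 - p) (\<^bold>\<not> \<phi>)"

abbreviation Pl_ge where "Pl_ge p \<phi> \<equiv> PlB p 0 \<phi>"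
abbreviation Bel_ge where "Bel_ge p \<phi> \<equiv> PlB 0 p \<phi>"
abbreviation Pl_le where "Pl_le p \<phi> \<equiv> PlB 0 (1 - p) (\<^bold>\<not> \<phi>)"
abbreviation Bel_le where "Bel_le p \<phi> \<equiv> PlB (1 - p) 0 (\<^bold>\<not> \<phi>)"
abbreviation Pl_lt where "Pl_lt p \<phi> \<equiv> \<^bold>\<not> Pl_ge p \<phi>"

abbreviation Ps_ge where "Ps_ge p \<phi> \<equiv> PsN p 0 \<phi>"
abbreviation N_ge where "N_ge p \<phi> \<equiv> PsN 0 p \<phi>"
abbreviation Ps_le where "Ps_le p \<phi> \<equiv> PsN 0 (1 - p) (\<^bold>\<not> \<phi>)"
abbreviation N_le where "N_le p \<phi> \<equiv> PsN (1 - p) 0 (\<^bold>\<not> \<phi>)"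
abbreviation Ps_lt where "Ps_lt p \<phi> \<equiv> \<^bold>\<not> Ps_ge p \<phi>"

definition Pl_par :: "nat \<Rightarrow> real \<Rightarrow> 'm form \<Rightarrow> 'm form" where
  "Pl_par i p \<phi> = (if odd i then Pl_le p \<phi> else Pl_ge p \<phi>)"


section \<open>Axioms\<close>

text \<open>
  Propositional truth value of a formula; every formula that is neither \<open>\<bottom>\<close> nor an implication
  is treated as an atom.
\<close>

primrec bool_val :: "('m form \<Rightarrow> bool) \<Rightarrow> 'm form \<Rightarrow> bool" where
  "bool_val v \<^bold>\<bottom> \<longleftrightarrow> False"
| "bool_val v (\<phi> \<^bold>\<longrightarrow> \<psi>) \<longleftrightarrow> (bool_val v \<phi> \<longrightarrow> bool_val v \<psi>)"
| "bool_val v (Cst A) \<longleftrightarrow> v (Cst A)"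
| "bool_val v (Box \<kappa> \<phi>) \<longleftrightarrow> v (Box \<kappa> \<phi>)"
| "bool_val v (UL p q \<phi>) \<longleftrightarrow> v (UL p q \<phi>)"
| "bool_val v (P_ge p \<phi>) \<longleftrightarrow> v (P_ge p \<phi>)"
| "bool_val v (PlB p q \<phi>) \<longleftrightarrow> v (PlB p q \<phi>)"
| "bool_val v (PsN p q \<phi>) \<longleftrightarrow> v (PsN p q \<phi>)"

definition tautology :: "'m form \<Rightarrow> bool" where
  "tautology \<phi> \<longleftrightarrow> (\<forall>v. bool_val v \<phi>)"

abbreviation nonempty_subsets :: "nat \<Rightarrow> nat set set" where
  "nonempty_subsets n \<equiv> {I. I \<noteq> {} \<and> I \<subseteq> {1..n}}"

inductive Ax :: "'m upf \<Rightarrow> 'm upf \<Rightarrow> 'm form \<Rightarrow> bool" for T :: "'m upf" where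
  Taut: "\<phi> \<in> Form T S \<Longrightarrow> tautology \<phi> \<Longrightarrow> Ax T S \<phi>"
  \<comment> \<open>constants\<close>
| Const_in: "Cst A \<in> Form T (ConstF M \<Sigma>) \<Longrightarrow> c \<in> M \<Longrightarrow> c \<in> A \<Longrightarrow>
    Ax T (ConstF M \<Sigma>) (Cst {c} \<^bold>\<longrightarrow> Cst A)"
| Const_notin: "Cst A \<in> Form T (ConstF M \<Sigma>) \<Longrightarrow> c \<in> M \<Longrightarrow> c \<notin> A \<Longrightarrow>
    Ax T (ConstF M \<Sigma>) (Cst {c} \<^bold>\<longrightarrow> \<^bold>\<not> Cst A)"
  \<comment> \<open>non-probabilistic labels\<close>
| Box_neg: "step T \<kappa> S S' \<Longrightarrow> \<phi> \<in> Form T S' \<Longrightarrow>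
    Ax T S ((\<^bold>\<not> Box \<kappa> \<phi>) \<^bold>\<longrightarrow> Box \<kappa> (\<^bold>\<not> \<phi>))"
| Pr1_bot: "Ax T (ProdF S1 S2) (\<^bold>\<not> Box Pr1 \<^bold>\<bottom>)"
| Pr2_bot: "Ax T (ProdF S1 S2) (\<^bold>\<not> Box Pr2 \<^bold>\<bottom>)"
| In_bot: "Ax T (SumF S1 S2) ((\<^bold>\<not> Box In1 \<^bold>\<bottom>) \<^bold>\<longleftrightarrow> Box In2 \<^bold>\<bottom>)"
| Next_bot: "Ax T IdF (\<^bold>\<not> Box Next \<^bold>\<bottom>)"
  \<comment> \<open>\<open>\<Delta>\<^sup>*S\<close>\<close>
| U_le_lt: "\<phi> \<in> MForm T S \<Longrightarrow> p \<in> {0..1} \<Longrightarrow> q \<in> {0..1} \<Longrightarrow> p < q \<Longrightarrow>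
    Ax T (UpperF S) (U_le p \<phi> \<^bold>\<longrightarrow> U_lt q \<phi>)"
| U_lt_le: "\<phi> \<in> MForm T S \<Longrightarrow> p \<in> {0..1} \<Longrightarrow>
    Ax T (UpperF S) (U_lt p \<phi> \<^bold>\<longrightarrow> U_le p \<phi>)"
| U_mono: "\<phi> \<in> MForm T S \<Longrightarrow> \<psi> \<in> MForm T S \<Longrightarrow> p \<in> {0..1} \<Longrightarrow>
    Ax T (UpperF S) (L_ge 1 (\<phi> \<^bold>\<longrightarrow> \<psi>) \<^bold>\<longrightarrow> (U_ge p \<phi> \<^bold>\<longrightarrow> U_ge p \<psi>))"
| U_pair: "\<phi> \<in> MForm T S \<Longrightarrow> p \<in> {0..1} \<Longrightarrow> q \<in> {0..1} \<Longrightarrow>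
    Ax T (UpperF S) (UL p q \<phi> \<^bold>\<longleftrightarrow> (U_ge p \<phi> \<^bold>\<and> L_ge q \<phi>))"
  \<comment> \<open>\<open>\<Delta>S\<close>\<close>
| P_le_lt: "\<phi> \<in> MForm T S \<Longrightarrow> p \<in> {0..1} \<Longrightarrow> q \<in> {0..1} \<Longrightarrow> p < q \<Longrightarrow>
    Ax T (ProbF S) (P_le p \<phi> \<^bold>\<longrightarrow> P_lt q \<phi>)"
| P_lt_le: "\<phi> \<in> MForm T S \<Longrightarrow> p \<in> {0..1} \<Longrightarrow>
    Ax T (ProbF S) (P_lt p \<phi> \<^bold>\<longrightarrow> P_le p \<phi>)"
| P_mono: "\<phi> \<in> MForm T S \<Longrightarrow> \<psi> \<in> MForm T S \<Longrightarrow> p \<in> {0..1} \<Longrightarrow>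
    Ax T (ProbF S) (P_ge 1 (\<phi> \<^bold>\<longrightarrow> \<psi>) \<^bold>\<longrightarrow> (P_ge p \<phi> \<^bold>\<longrightarrow> P_ge p \<psi>))"
  \<comment> \<open>\<open>\<Delta>\<^sub>P\<^sub>l S\<close>\<close>
| Pl_le_lt: "\<phi> \<in> MForm T S \<Longrightarrow> p \<in> {0..1} \<Longrightarrow> q \<in> {0..1} \<Longrightarrow> p < q \<Longrightarrow>
    Ax T (PlausF S) (Pl_le p \<phi> \<^bold>\<longrightarrow> Pl_lt q \<phi>)"
| Pl_lt_le: "\<phi> \<in> MForm T S \<Longrightarrow> p \<in> {0..1} \<Longrightarrow>
    Ax T (PlausF S) (Pl_lt p \<phi> \<^bold>\<longrightarrow> Pl_le p \<phi>)"
| Pl_Bel: "\<phi> \<in> MForm T S \<Longrightarrow> p \<in> {0..1} \<Longrightarrow>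
    Ax T (PlausF S) (Pl_le p \<phi> \<^bold>\<longrightarrow> Bel_le p \<phi>)"
| Pl_mono: "\<phi> \<in> MForm T S \<Longrightarrow> \<psi> \<in> MForm T S \<Longrightarrow> p \<in> {0..1} \<Longrightarrow>
    Ax T (PlausF S) (Bel_ge 1 (\<phi> \<^bold>\<longrightarrow> \<psi>) \<^bold>\<longrightarrow> (Pl_ge p \<phi> \<^bold>\<longrightarrow> Pl_ge p \<psi>))"
| Pl_pair: "\<phi> \<in> MForm T S \<Longrightarrow> p \<in> {0..1} \<Longrightarrow> q \<in> {0..1} \<Longrightarrow>
    Ax T (PlausF S) (PlB p q \<phi> \<^bold>\<longleftrightarrow> (Pl_ge p \<phi> \<^bold>\<and> Bel_ge q \<phi>))"
| Pl_incl_excl: "1 \<le> n \<Longrightarrow> (\<forall>i\<in>{1..n}. \<phi>s i \<in> MForm T S) \<Longrightarrow>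
    (\<forall>I\<in>nonempty_subsets n. r I \<in> {0..1}) \<Longrightarrow>
    q = (\<Sum>I\<in>nonempty_subsets n. (- 1) ^ (card I + 1) * r I) \<Longrightarrow>
    q \<ge> 0 \<Longrightarrow> p = min q 1 \<Longrightarrow>
    Ax T (PlausF S)
      (BigAnd (nonempty_subsets n) (\<lambda>I. Pl_par (card I) (r I) (BigOr I \<phi>s))
        \<^bold>\<longrightarrow> Pl_le p (BigAnd {1..n} \<phi>s))"
| Pl_incl_excl_neg: "1 \<le> n \<Longrightarrow> (\<forall>i\<in>{1..n}. \<phi>s i \<in> MForm T S) \<Longrightarrow>
    (\<forall>I\<in>nonempty_subsets n. r I \<in> {0..1}) \<Longrightarrow>
    q = (\<Sum>I\<in>nonempty_subsets n. (- 1) ^ (card I + 1) * r I) \<Longrightarrow>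
    q < 0 \<Longrightarrow>
    Ax T (PlausF S)
      (\<^bold>\<not> BigAnd (nonempty_subsets n) (\<lambda>I. Pl_par (card I) (r I) (BigOr I \<phi>s)))"
  \<comment> \<open>\<open>\<Delta>\<^sub>P\<^sub>s S\<close>\<close>
| Ps_le_lt: "\<phi> \<in> MForm T S \<Longrightarrow> p \<in> {0..1} \<Longrightarrow> q \<in> {0..1} \<Longrightarrow> p < q \<Longrightarrow>
    Ax T (PossF S) (Ps_le p \<phi> \<^bold>\<longrightarrow> Ps_lt q \<phi>)"
| Ps_lt_le: "\<phi> \<in> MForm T S \<Longrightarrow> p \<in> {0..1} \<Longrightarrow>
    Ax T (PossF S) (Ps_lt p \<phi> \<^bold>\<longrightarrow> Ps_le p \<phi>)"
| Ps_bot: "Ax T (PossF S) (Ps_le 0 \<^bold>\<bottom>)"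
| Ps_N: "\<phi> \<in> MForm T S \<Longrightarrow> p \<in> {0..1} \<Longrightarrow>
    Ax T (PossF S) (Ps_le p \<phi> \<^bold>\<longrightarrow> N_le p \<phi>)"
| Ps_max: "\<phi> \<in> MForm T S \<Longrightarrow> \<psi> \<in> MForm T S \<Longrightarrow> p \<in> {0..1} \<Longrightarrow> q \<in> {0..1} \<Longrightarrow>
    Ax T (PossF S) ((Ps_le p \<phi> \<^bold>\<and> Ps_le q \<psi>) \<^bold>\<longrightarrow> Ps_le (max p q) (\<phi> \<^bold>\<or> \<psi>))"
| Ps_mono: "\<phi> \<in> MForm T S \<Longrightarrow> \<psi> \<in> MForm T S \<Longrightarrow> p \<in> {0..1} \<Longrightarrow>
    Ax T (PossF S) (N_ge 1 (\<phi> \<^bold>\<longrightarrow> \<psi>) \<^bold>\<longrightarrow> (Ps_ge p \<phi> \<^bold>\<longrightarrow> Ps_ge p \<psi>))"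
| Ps_pair: "\<phi> \<in> MForm T S \<Longrightarrow> p \<in> {0..1} \<Longrightarrow> q \<in> {0..1} \<Longrightarrow>
    Ax T (PossF S) (PsN p q \<phi> \<^bold>\<longleftrightarrow> (Ps_ge p \<phi> \<^bold>\<and> N_ge q \<phi>))"


section \<open>Deduction systems\<close>

type_synonym 'm entailment = "'m upf \<Rightarrow> 'm form set \<Rightarrow> 'm form \<Rightarrow> bool"

definition archimedean ::
  "'m upf \<Rightarrow> 'm entailment \<Rightarrow> 'm upf \<Rightarrow> 'm upf \<Rightarrow> (real \<Rightarrow> 'm form \<Rightarrow> 'm form) \<Rightarrow> bool" where
  "archimedean T D R S O_ge \<longleftrightarrow>
     (\<forall>\<psi>\<in>MForm T S. \<forall>p\<in>{0..1}. D R {O_ge q \<psi> |q. q \<in> {0..1} \<and> q < p} (O_ge p \<psi>))"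

text \<open>\<open>at_least k m \<phi>s\<close>: some \<open>k\<close> of the formulas \<open>\<phi>s 1, \<dots>, \<phi>s m\<close> hold simultaneously.\<close>

definition at_least :: "nat \<Rightarrow> nat \<Rightarrow> (nat \<Rightarrow> 'm form) \<Rightarrow> 'm form" where
  "at_least k m \<phi>s = BigOr {I. I \<subseteq> {1..m} \<and> card I = k} (\<lambda>I. BigAnd I \<phi>s)"

definition cover_rules ::
  "'m upf \<Rightarrow> 'm entailment \<Rightarrow> 'm upf \<Rightarrow> 'm upf \<Rightarrow> (real \<Rightarrow> 'm form \<Rightarrow> 'm form) \<Rightarrow> bool" where
  "cover_rules T D R S O_le \<longleftrightarrow>
     (\<forall>\<phi> \<phi>s r p n k m. 1 \<le> n \<longrightarrow> 1 \<le> m \<longrightarrow> \<phi> \<in> MForm T S \<longrightarrow>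
        (\<forall>i\<in>{1..m}. \<phi>s i \<in> MForm T S \<and> r i \<in> {0..1}) \<longrightarrow>
        D S {} (\<phi> \<^bold>\<longrightarrow> at_least (n + k) m \<phi>s) \<longrightarrow> D S {} (at_least k m \<phi>s) \<longrightarrow>
        p = max 0 (min 1 (((\<Sum>i=1..m. r i) - real k) / real n)) \<longrightarrow>
        D R {} (BigAnd {1..m} (\<lambda>i. O_le (r i) (\<phi>s i)) \<^bold>\<longrightarrow> O_le p \<phi>)) \<and>
     (\<forall>\<phi>s r k m. 1 \<le> m \<longrightarrow>
        (\<forall>i\<in>{1..m}. \<phi>s i \<in> MForm T S \<and> r i \<in> {0..1}) \<longrightarrow>
        D S {} (at_least k m \<phi>s) \<longrightarrow> (\<Sum>i=1..m. r i) < real k \<longrightarrow>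
        D R {} (\<^bold>\<not> BigAnd {1..m} (\<lambda>i. O_le (r i) (\<phi>s i))))"

text \<open>
  \<open>D S \<Gamma> \<phi>\<close> is \<open>\<Gamma> \<turnstile>\<^sub>S \<phi>\<close>. The family is indexed by the ingredients of \<open>T\<close>: values of \<open>D\<close> at
  other functors are unconstrained and play no role.
\<close>

locale deduction_system =
  fixes T :: "'m upf" and D :: "'m entailment"
  assumes well_sorted:
      "\<And>S \<Gamma> \<phi>. S \<in> Ing T \<Longrightarrow> D S \<Gamma> \<phi> \<Longrightarrow> \<Gamma> \<subseteq> Form T S \<and> \<phi> \<in> Form T S"
    and assumption:
      "\<And>S \<Gamma> \<phi>. S \<in> Ing T \<Longrightarrow> \<Gamma> \<subseteq> Form T S \<Longrightarrow> \<phi> \<in> \<Gamma> \<or> Ax T S \<phi> \<Longrightarrow> D S \<Gamma> \<phi>"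
    and modus_ponens:
      "\<And>S \<phi> \<psi>. S \<in> Ing T \<Longrightarrow> \<phi> \<in> Form T S \<Longrightarrow> \<psi> \<in> Form T S \<Longrightarrow> D S {\<phi>, \<phi> \<^bold>\<longrightarrow> \<psi>} \<psi>"
    and cut:
      "\<And>S \<Gamma> \<Lambda> \<phi>. S \<in> Ing T \<Longrightarrow> \<Gamma> \<subseteq> Form T S \<Longrightarrow>
         (\<And>\<psi>. \<psi> \<in> \<Lambda> \<Longrightarrow> D S \<Gamma> \<psi>) \<Longrightarrow> D S \<Lambda> \<phi> \<Longrightarrow> D S \<Gamma> \<phi>"
    and deduction:
      "\<And>S \<Gamma> \<phi> \<psi>. S \<in> Ing T \<Longrightarrow> D S (\<Gamma> \<union> {\<phi>}) \<psi> \<Longrightarrow> D S \<Gamma> (\<phi> \<^bold>\<longrightarrow> \<psi>)"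
    and constant_rule:
      "\<And>M \<Sigma>. ConstF M \<Sigma> \<in> Ing T \<Longrightarrow> D (ConstF M \<Sigma>) {\<^bold>\<not> Cst {c} |c. c \<in> M} \<^bold>\<bottom>"
    and definite_box:
      "\<And>\<kappa> S S' \<Gamma> \<psi>. S \<in> Ing T \<Longrightarrow> step T \<kappa> S S' \<Longrightarrow> D S' \<Gamma> \<psi> \<Longrightarrow> D S (Box \<kappa> ` \<Gamma>) (Box \<kappa> \<psi>)"
    and necessitation_U:
      "\<And>S \<phi>. UpperF S \<in> Ing T \<Longrightarrow> \<phi> \<in> MForm T S \<Longrightarrow> D S {} \<phi> \<Longrightarrow> D (UpperF S) {} (L_ge 1 \<phi>)"
    and necessitation_P:
      "\<And>S \<phi>. ProbF S \<in> Ing T \<Longrightarrow> \<phi> \<in> MForm T S \<Longrightarrow> D S {} \<phi> \<Longrightarrow> D (ProbF S) {} (P_ge 1 \<phi>)"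
    and necessitation_Pl:
      "\<And>S \<phi>. PlausF S \<in> Ing T \<Longrightarrow> \<phi> \<in> MForm T S \<Longrightarrow> D S {} \<phi> \<Longrightarrow> D (PlausF S) {} (Bel_ge 1 \<phi>)"
    and necessitation_Ps:
      "\<And>S \<phi>. PossF S \<in> Ing T \<Longrightarrow> \<phi> \<in> MForm T S \<Longrightarrow> D S {} \<phi> \<Longrightarrow> D (PossF S) {} (N_ge 1 \<phi>)"
    and archimedean_U: "\<And>S. UpperF S \<in> Ing T \<Longrightarrow> archimedean T D (UpperF S) S U_ge"
    and archimedean_L: "\<And>S. UpperF S \<in> Ing T \<Longrightarrow> archimedean T D (UpperF S) S L_ge"
    and archimedean_P: "\<And>S. ProbF S \<in> Ing T \<Longrightarrow> archimedean T D (ProbF S) S P_ge"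
    and archimedean_Pl: "\<And>S. PlausF S \<in> Ing T \<Longrightarrow> archimedean T D (PlausF S) S Pl_ge"
    and archimedean_Bel: "\<And>S. PlausF S \<in> Ing T \<Longrightarrow> archimedean T D (PlausF S) S Bel_ge"
    and archimedean_Ps: "\<And>S. PossF S \<in> Ing T \<Longrightarrow> archimedean T D (PossF S) S Ps_ge"
    and archimedean_N: "\<And>S. PossF S \<in> Ing T \<Longrightarrow> archimedean T D (PossF S) S N_ge"
    and cover_U: "\<And>S. UpperF S \<in> Ing T \<Longrightarrow> cover_rules T D (UpperF S) S U_le"
    and cover_P: "\<And>S. ProbF S \<in> Ing T \<Longrightarrow> cover_rules T D (ProbF S) S P_le"


section \<open>Maximal sets and the canonical spaces\<close>

definition consistent :: "'m entailment \<Rightarrow> 'm upf \<Rightarrow> 'm form set \<Rightarrow> bool" where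
  "consistent D S \<Gamma> \<longleftrightarrow> \<not> D S \<Gamma> \<^bold>\<bottom>"

definition maximal :: "'m upf \<Rightarrow> 'm entailment \<Rightarrow> 'm upf \<Rightarrow> 'm form set \<Rightarrow> bool" where
  "maximal T D S \<Gamma> \<longleftrightarrow>
     \<Gamma> \<subseteq> Form T S \<and> consistent D S \<Gamma> \<and> (\<forall>\<phi>\<in>Form T S. \<phi> \<in> \<Gamma> \<longleftrightarrow> (\<^bold>\<not> \<phi>) \<notin> \<Gamma>)"

definition lindenbaum :: "'m upf \<Rightarrow> 'm entailment \<Rightarrow> bool" where
  "lindenbaum T D \<longleftrightarrow>
     (\<forall>S\<in>Ing T. \<forall>\<Gamma>\<subseteq>Form T S. consistent D S \<Gamma> \<longrightarrow> (\<exists>y. maximal T D S y \<and> \<Gamma> \<subseteq> y))"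

definition canon :: "'m upf \<Rightarrow> 'm entailment \<Rightarrow> 'm upf \<Rightarrow> 'm form set set" where
  "canon T D S = {y. maximal T D S y}"

definition truth_set :: "'m upf \<Rightarrow> 'm entailment \<Rightarrow> 'm upf \<Rightarrow> 'm form \<Rightarrow> 'm form set set" where
  "truth_set T D S \<phi> = {y \<in> canon T D S. \<phi> \<in> y}"

definition canon_algebra :: "'m upf \<Rightarrow> 'm entailment \<Rightarrow> 'm upf \<Rightarrow> 'm form set set set" where
  "canon_algebra T D S = truth_set T D S ` MForm T S"

definition poss_sup :: "'m form set \<Rightarrow> 'm form \<Rightarrow> real" where
  "poss_sup x \<phi> = Sup {q. q \<in> {0..1} \<and> Ps_ge q \<phi> \<in> x}"

end

theory Submission
  imports Defs
begin

text \<open>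
  In a maximal set \<open>x\<close> the thresholds \<open>q\<close> with \<open>Ps_ge q \<phi> \<in> x\<close> form a closed interval \<open>{0..s}\<close>, and the
  Archimedean rule for the necessity operator gives \<open>Ps_le p \<phi> \<in> x\<close> exactly when \<open>s \<le> p\<close>. Hence
  the axioms for \<open>Ps_le\<close> translate directly into (in)equalities between suprema; monotonicity in
  the truth set comes from the Lindenbaum property and necessitation.
\<close>

section \<open>Ingredients and sorts\<close>

lemma Ing_refl: "S \<in> Ing S"
  by (cases S) auto

text \<open>Serves to pass from \<open>PossF S \<in> Ing T\<close> to \<open>S \<in> Ing T\<close>:
  the rules of \<open>D\<close> are available at ingredients only.\<close>

lemma Ing_trans: "S \<in> Ing R \<Longrightarrow> R \<in> Ing T \<Longrightarrow> S \<in> Ing T"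
  by (induction T) auto

lemma Bot_in_Form [simp]: "\<^bold>\<bottom> \<in> Form T S"
  by (simp add: Form_def)

lemma Imp_in_Form [simp]: "(\<phi> \<^bold>\<longrightarrow> \<psi>) \<in> Form T S \<longleftrightarrow> \<phi> \<in> Form T S \<and> \<psi> \<in> Form T S"
  by (simp add: Form_def)

lemma Bot_in_MForm [simp]: "\<^bold>\<bottom> \<in> MForm T S"
  by (simp add: MForm_def)

lemma Imp_in_MForm [simp]: "(\<phi> \<^bold>\<longrightarrow> \<psi>) \<in> MForm T S \<longleftrightarrow> \<phi> \<in> MForm T S \<and> \<psi> \<in> MForm T S"
  by (auto simp: MForm_def)

lemma MForm_imp_Form: "\<phi> \<in> MForm T S \<Longrightarrow> \<phi> \<in> Form T S"
  by (simp add: MForm_def Form_def)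

text \<open>The abbreviations \<open>Ps_ge\<close>, \<open>N_ge\<close>, \<open>Ps_le\<close> and
  \<open>N_le\<close> all unfold to \<open>PsN\<close>, so this one rule discharges their sorting
  conditions.\<close>

lemma PsN_in_Form [simp]:
  "PsN p q \<phi> \<in> Form T (PossF S) \<longleftrightarrow> p \<in> {0..1} \<and> q \<in> {0..1} \<and> \<phi> \<in> MForm T S"
  by (auto simp: MForm_def Form_def)

section \<open>Maximal sets, truth sets and the canonical algebra\<close>

context deduction_system
begin

text \<open>If the conclusion were missing, negation completeness would put its negation into
  \<open>y\<close>; cut and modus ponens would then derive falsum from \<open>y\<close>.\<close>

lemma entails_in_maximal:
  assumes S: "S \<in> Ing T" and y: "maximal T D S y" and d: "D S \<Gamma> \<phi>" and sub: "\<Gamma> \<subseteq> y"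
  shows "\<phi> \<in> y"
proof (rule ccontr)
  assume "\<phi> \<notin> y"
  have yF: "y \<subseteq> Form T S" using y unfolding maximal_def by blast
  have \<phi>F: "\<phi> \<in> Form T S" using well_sorted[OF S d] by simp
  have mem: "D S y \<psi>" if "\<psi> \<in> y" for \<psi>
    by (rule assumption[OF S yF disjI1[OF that]])
  have "(\<^bold>\<not> \<phi>) \<in> y" using y \<phi>F \<open>\<phi> \<notin> y\<close> unfolding maximal_def by blast
  then have neg: "D S y (\<^bold>\<not> \<phi>)" by (rule mem)
  have pos: "D S y \<phi>"
    by (rule cut[OF S yF mem d]) (rule subsetD[OF sub])
  have "D S y \<^bold>\<bottom>"
  proof (rule cut[OF S yF _ modus_ponens[OF S \<phi>F Bot_in_Form]])
    show "D S y \<psi>" if "\<psi> \<in> {\<phi>, \<^bold>\<not> \<phi>}" for \<psi>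
      using that neg pos by blast
  qed
  with y show False unfolding maximal_def consistent_def by blast
qed

lemma Ax_in_maximal:
  assumes "S \<in> Ing T" "maximal T D S y" "Ax T S \<phi>"
  shows "\<phi> \<in> y"
  by (rule entails_in_maximal[OF assms(1,2) assumption[OF assms(1) empty_subsetI disjI2[OF assms(3)]]])
    simp

lemma maximal_subset: "maximal T D S y \<Longrightarrow> y \<subseteq> Form T S"
  unfolding maximal_def by blast

lemma Neg_in_maximal:
  assumes "maximal T D S y" "\<phi> \<in> Form T S"
  shows "(\<^bold>\<not> \<phi>) \<in> y \<longleftrightarrow> \<phi> \<notin> y"
  using assms unfolding maximal_def by blast

lemma Bot_notin_maximal:
  assumes "S \<in> Ing T" "maximal T D S y"
  shows "\<^bold>\<bottom> \<notin> y"
  using assms assumption[of S y "\<^bold>\<bottom>"] unfolding maximal_def consistent_def by blast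

text \<open>One direction is modus ponens; the other applies modus ponens to the tautologies for ex
  falso and weakening.\<close>

lemma Imp_in_maximal:
  assumes S: "S \<in> Ing T" and y: "maximal T D S y" and F: "\<phi> \<in> Form T S" "\<psi> \<in> Form T S"
  shows "(\<phi> \<^bold>\<longrightarrow> \<psi>) \<in> y \<longleftrightarrow> (\<phi> \<in> y \<longrightarrow> \<psi> \<in> y)"
proof
  \<comment> \<open>Proved for arbitrary formulas, not just the fixed pair, because the converse
    direction applies it to the two tautologies.\<close>
  show mp: "\<phi> \<in> y \<longrightarrow> \<psi> \<in> y" if "(\<phi> \<^bold>\<longrightarrow> \<psi>) \<in> y" for \<phi> \<psi>
  proof
    assume "\<phi> \<in> y"
    have "\<phi> \<in> Form T S" "\<psi> \<in> Form T S" using that y by (auto dest!: maximal_subset)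
    then show "\<psi> \<in> y"
      using entails_in_maximal[OF S y modus_ponens[OF S]] that \<open>\<phi> \<in> y\<close> by blast
  qed
  assume imp: "\<phi> \<in> y \<longrightarrow> \<psi> \<in> y"
  have "((\<^bold>\<not> \<phi>) \<^bold>\<longrightarrow> (\<phi> \<^bold>\<longrightarrow> \<psi>)) \<in> y" "(\<psi> \<^bold>\<longrightarrow> (\<phi> \<^bold>\<longrightarrow> \<psi>)) \<in> y"
    using F by (auto intro!: Ax_in_maximal[OF S y] Taut simp: tautology_def)
  then show "(\<phi> \<^bold>\<longrightarrow> \<psi>) \<in> y"
    using mp imp Neg_in_maximal[OF y F(1)] by blast
qed

lemma And_in_maximal:
  assumes "S \<in> Ing T" "maximal T D S y" "\<phi> \<in> Form T S" "\<psi> \<in> Form T S"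
  shows "(\<phi> \<^bold>\<and> \<psi>) \<in> y \<longleftrightarrow> \<phi> \<in> y \<and> \<psi> \<in> y"
  using assms by (simp add: Imp_in_maximal Bot_notin_maximal)

lemma truth_set_Bot:
  assumes "S \<in> Ing T"
  shows "truth_set T D S \<^bold>\<bottom> = {}"
  using Bot_notin_maximal[OF assms] by (auto simp: truth_set_def canon_def)

lemma truth_set_Neg:
  assumes "\<phi> \<in> Form T S"
  shows "truth_set T D S (\<^bold>\<not> \<phi>) = canon T D S - truth_set T D S \<phi>"
  using assms by (auto simp: truth_set_def canon_def Neg_in_maximal)

lemma truth_set_Or:
  assumes "S \<in> Ing T" "\<phi> \<in> Form T S" "\<psi> \<in> Form T S"
  shows "truth_set T D S (\<phi> \<^bold>\<or> \<psi>) = truth_set T D S \<phi> \<union> truth_set T D S \<psi>"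
  using assms by (auto simp: truth_set_def canon_def Imp_in_maximal Bot_notin_maximal)

text \<open>Complement and union of truth sets correspond to negation and disjunction, and
  \<open>MForm\<close> is closed under both connectives.\<close>

lemma algebra_canon:
  assumes "S \<in> Ing T"
  shows "algebra (canon T D S) (canon_algebra T D S)"
  unfolding algebra_iff_Un
proof (intro conjI ballI)
  show "canon_algebra T D S \<subseteq> Pow (canon T D S)"
    by (auto simp: canon_algebra_def truth_set_def)
  show "{} \<in> canon_algebra T D S"
    unfolding canon_algebra_def truth_set_Bot[OF assms, symmetric] by simp
next
  fix a assume "a \<in> canon_algebra T D S"
  then obtain \<phi> where "\<phi> \<in> MForm T S" "a = truth_set T D S \<phi>"
    by (auto simp: canon_algebra_def)
  then have "canon T D S - a = truth_set T D S (\<^bold>\<not> \<phi>)" "(\<^bold>\<not> \<phi>) \<in> MForm T S"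
    by (simp_all add: truth_set_Neg MForm_imp_Form)
  then show "canon T D S - a \<in> canon_algebra T D S"
    by (simp only: canon_algebra_def) blast
next
  fix a b assume "a \<in> canon_algebra T D S" "b \<in> canon_algebra T D S"
  then obtain \<phi> \<psi> where "\<phi> \<in> MForm T S" "a = truth_set T D S \<phi>"
    "\<psi> \<in> MForm T S" "b = truth_set T D S \<psi>"
    by (auto simp: canon_algebra_def)
  then have "a \<union> b = truth_set T D S (\<phi> \<^bold>\<or> \<psi>)" "(\<phi> \<^bold>\<or> \<psi>) \<in> MForm T S"
    by (simp_all add: truth_set_Or assms MForm_imp_Form)
  then show "a \<union> b \<in> canon_algebra T D S"
    by (simp only: canon_algebra_def) blast
qed

text \<open>If the negated implication were consistent, the Lindenbaum property would place it in
  some maximal set, a point of the first truth set outside the second.\<close>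

lemma truth_set_subset_derivable:
  assumes lind: "lindenbaum T D" and S: "S \<in> Ing T"
    and F: "\<phi> \<in> Form T S" "\<psi> \<in> Form T S"
    and sub: "truth_set T D S \<phi> \<subseteq> truth_set T D S \<psi>"
  shows "D S {} (\<phi> \<^bold>\<longrightarrow> \<psi>)"
proof -
  have "D S {\<^bold>\<not> (\<phi> \<^bold>\<longrightarrow> \<psi>)} \<^bold>\<bottom>"
  proof (rule ccontr)
    assume "\<not> ?thesis"
    then have "consistent D S {\<^bold>\<not> (\<phi> \<^bold>\<longrightarrow> \<psi>)}"
      by (simp add: consistent_def)
    moreover have "{\<^bold>\<not> (\<phi> \<^bold>\<longrightarrow> \<psi>)} \<subseteq> Form T S"
      using F by simp
    ultimately obtain y where y: "maximal T D S y" "(\<^bold>\<not> (\<phi> \<^bold>\<longrightarrow> \<psi>)) \<in> y"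
      using lind S unfolding lindenbaum_def by blast
    then have "\<phi> \<in> y" "\<psi> \<notin> y"
      using F by (simp_all add: Imp_in_maximal[OF S y(1)] Bot_notin_maximal[OF S y(1)])
    with sub y show False by (auto simp: truth_set_def canon_def)
  qed
  \<comment> \<open>Deduction discharges the refuted premise but yields only a double negation,
    which the tautology \<open>dne\<close> removes.\<close>
  then have nn: "D S {} (\<^bold>\<not> \<^bold>\<not> (\<phi> \<^bold>\<longrightarrow> \<psi>))"
    using deduction[OF S, of "{}"] by simp
  have dne: "D S {} ((\<^bold>\<not> \<^bold>\<not> (\<phi> \<^bold>\<longrightarrow> \<psi>)) \<^bold>\<longrightarrow> (\<phi> \<^bold>\<longrightarrow> \<psi>))"
    using F by (intro assumption[OF S] disjI2 Taut) (auto simp: tautology_def)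
  show ?thesis
  proof (rule cut[OF S _ _ modus_ponens[OF S, of "\<^bold>\<not> \<^bold>\<not> (\<phi> \<^bold>\<longrightarrow> \<psi>)"]])
    show "D S {} \<chi>" if "\<chi> \<in> {\<^bold>\<not> \<^bold>\<not> (\<phi> \<^bold>\<longrightarrow> \<psi>), (\<^bold>\<not> \<^bold>\<not> (\<phi> \<^bold>\<longrightarrow> \<psi>)) \<^bold>\<longrightarrow> (\<phi> \<^bold>\<longrightarrow> \<psi>)}" for \<chi>
      using that nn dne by blast
  qed (use F in simp_all)
qed

end

section \<open>The supremum of thresholds at a fixed maximal set\<close>

locale canonical_possibility = deduction_system T D for T :: "'m upf" and D +
  fixes S :: "'m upf" and x :: "'m form set"
  assumes lind: "lindenbaum T D" and PossF_Ing: "PossF S \<in> Ing T" and x: "maximal T D (PossF S) x"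
begin

lemma S_Ing: "S \<in> Ing T"
  by (rule Ing_trans[OF _ PossF_Ing]) (simp add: Ing_refl)

lemmas Ax_in_x = Ax_in_maximal[OF PossF_Ing x]
lemmas Imp_in_x = Imp_in_maximal[OF PossF_Ing x]
lemmas Neg_in_x = Neg_in_maximal[OF x]
lemmas Bot_notin_x = Bot_notin_maximal[OF PossF_Ing x]
lemmas And_in_x = And_in_maximal[OF PossF_Ing x]

lemma archimedean_in_x:
  assumes "archimedean T D (PossF S) S O_ge" "\<phi> \<in> MForm T S" "p \<in> {0..1}"
    and "\<And>q. 0 \<le> q \<Longrightarrow> q < p \<Longrightarrow> O_ge q \<phi> \<in> x"
  shows "O_ge p \<phi> \<in> x"
  by (rule entails_in_maximal[OF PossF_Ing x, of "{O_ge q \<phi> |q. q \<in> {0..1} \<and> q < p}"])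
    (use assms in \<open>auto simp: archimedean_def\<close>)

lemma Ps_le_excludes:
  assumes "\<phi> \<in> MForm T S" "p \<in> {0..1}" "q \<in> {0..1}" "p < q" "Ps_le p \<phi> \<in> x"
  shows "Ps_ge q \<phi> \<notin> x"
  using Ax_in_x[OF Ps_le_lt[OF assms(1-4)]] assms by (simp add: Imp_in_x Bot_notin_x)

lemma not_Ps_ge_imp_Ps_le:
  assumes "\<phi> \<in> MForm T S" "p \<in> {0..1}" "Ps_ge p \<phi> \<notin> x"
  shows "Ps_le p \<phi> \<in> x"
  using Ax_in_x[OF Ps_lt_le[OF assms(1-2)]] assms by (simp add: Imp_in_x Neg_in_x)

text \<open>At threshold 0 the Archimedean rule has no premises. This makes the set of thresholds
  nonempty, as the least upper bound property requires.\<close>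

lemma Ps_ge_0_in_x:
  assumes "\<phi> \<in> MForm T S"
  shows "Ps_ge 0 \<phi> \<in> x"
  by (rule archimedean_in_x[OF archimedean_Ps[OF PossF_Ing] assms]) auto

lemma poss_sup_upper:
  assumes "q \<in> {0..1}" "Ps_ge q \<phi> \<in> x"
  shows "q \<le> poss_sup x \<phi>"
  unfolding poss_sup_def by (rule cSup_upper) (use assms in \<open>auto intro!: bdd_aboveI[of _ 1]\<close>)

lemma poss_sup_least:
  assumes "\<phi> \<in> MForm T S" "\<And>q. q \<in> {0..1} \<Longrightarrow> Ps_ge q \<phi> \<in> x \<Longrightarrow> q \<le> p"
  shows "poss_sup x \<phi> \<le> p"
  unfolding poss_sup_def
  by (rule cSup_least) (use assms Ps_ge_0_in_x[OF assms(1)] in \<open>auto intro!: exI[of _ 0]\<close>)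

lemma poss_sup_bounds:
  assumes "\<phi> \<in> MForm T S"
  shows "0 \<le> poss_sup x \<phi>" "poss_sup x \<phi> \<le> 1"
  using poss_sup_upper[OF _ Ps_ge_0_in_x[OF assms]] poss_sup_least[OF assms, of 1] by auto

text \<open>The bound \<open>p\<close> may equal the supremum: the Archimedean rule supplies this
  boundary case, which \<open>Ps_lt_le\<close> alone does not cover.\<close>

lemma Ps_le_iff:
  assumes \<phi>: "\<phi> \<in> MForm T S" and p: "p \<in> {0..1}"
  shows "Ps_le p \<phi> \<in> x \<longleftrightarrow> poss_sup x \<phi> \<le> p"
proof
  assume "Ps_le p \<phi> \<in> x"
  then show "poss_sup x \<phi> \<le> p"
    using Ps_le_excludes[OF \<phi> p] by (intro poss_sup_least[OF \<phi>]) (meson not_le)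
next
  assume le: "poss_sup x \<phi> \<le> p"
  show "Ps_le p \<phi> \<in> x"
  \<comment> \<open>\<open>Ps_le p \<phi>\<close> is \<open>N_ge\<close> at level
    \<open>1 - p\<close> of the negated formula. A level \<open>q\<close> below \<open>1 - p\<close>
    matches the threshold \<open>1 - q\<close>, which lies strictly above the supremum and so is not
    attained.\<close>
  proof (rule archimedean_in_x[OF archimedean_N[OF PossF_Ing]])
    fix q :: real assume q: "0 \<le> q" "q < 1 - p"
    then have r: "1 - q \<in> {0..1}" "poss_sup x \<phi> < 1 - q" using p le by auto
    then have "Ps_ge (1 - q) \<phi> \<notin> x" using poss_sup_upper[of "1 - q" \<phi>] by auto
    from not_Ps_ge_imp_Ps_le[OF \<phi> r(1) this] show "N_ge q (\<^bold>\<not> \<phi>) \<in> x" by simp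
  qed (use \<phi> p in auto)
qed

text \<open>Inclusion of truth sets makes the implication derivable; necessitation puts it into
  \<open>x\<close> with necessity 1, and \<open>Ps_mono\<close> then transfers every threshold.
  Well-definedness follows by applying this in both directions.\<close>

lemma poss_sup_mono:
  assumes \<phi>: "\<phi> \<in> MForm T S" and \<psi>: "\<psi> \<in> MForm T S"
    and sub: "truth_set T D S \<phi> \<subseteq> truth_set T D S \<psi>"
  shows "poss_sup x \<phi> \<le> poss_sup x \<psi>"
proof (rule poss_sup_least[OF \<phi>])
  have "D S {} (\<phi> \<^bold>\<longrightarrow> \<psi>)"
    by (intro truth_set_subset_derivable lind S_Ing sub MForm_imp_Form \<phi> \<psi>)
  then have "D (PossF S) {} (N_ge 1 (\<phi> \<^bold>\<longrightarrow> \<psi>))"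
    using \<phi> \<psi> by (intro necessitation_Ps PossF_Ing) simp_all
  then have N: "N_ge 1 (\<phi> \<^bold>\<longrightarrow> \<psi>) \<in> x"
    by (rule entails_in_maximal[OF PossF_Ing x]) simp
  fix q :: real assume q: "q \<in> {0..1}" "Ps_ge q \<phi> \<in> x"
  then have "Ps_ge q \<psi> \<in> x"
    using Ax_in_x[OF Ps_mono[OF \<phi> \<psi> q(1)]] N \<phi> \<psi> by (simp add: Imp_in_x)
  with q show "q \<le> poss_sup x \<psi>" by (intro poss_sup_upper)
qed

lemma poss_sup_cong:
  assumes "\<phi> \<in> MForm T S" "\<psi> \<in> MForm T S" "truth_set T D S \<phi> = truth_set T D S \<psi>"
  shows "poss_sup x \<phi> = poss_sup x \<psi>"
  using poss_sup_mono[of \<phi> \<psi>] poss_sup_mono[of \<psi> \<phi>] assms by simp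

lemma poss_sup_Bot: "poss_sup x \<^bold>\<bottom> = 0"
  using Ps_le_iff[of "\<^bold>\<bottom>" 0] Ax_in_x[OF Ps_bot] poss_sup_bounds[of "\<^bold>\<bottom>"] by simp

lemma poss_sup_Top: "poss_sup x \<^bold>\<top> = 1"
proof -
  \<comment> \<open>This unfolds to \<open>Ps_ge (1 - 0)\<close> of the negation of falsum, so the
    threshold 1 is attained at truth.\<close>
  have "N_le 0 \<^bold>\<bottom> \<in> x"
    using Ax_in_x[OF Ps_N[of "\<^bold>\<bottom>" T S 0]] Ax_in_x[OF Ps_bot] by (simp add: Imp_in_x)
  then show ?thesis
    using poss_sup_upper[of 1 "\<^bold>\<top>"] poss_sup_bounds[of "\<^bold>\<top>"] by simp
qed

text \<open>The upper bound is the axiom \<open>Ps_max\<close> taken exactly at the two suprema,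
  which \<open>Ps_le_iff\<close> permits; the lower bound is monotonicity.\<close>

lemma poss_sup_Or:
  assumes \<phi>: "\<phi> \<in> MForm T S" and \<psi>: "\<psi> \<in> MForm T S"
  shows "poss_sup x (\<phi> \<^bold>\<or> \<psi>) = max (poss_sup x \<phi>) (poss_sup x \<psi>)"
proof (rule antisym)
  let ?p = "poss_sup x \<phi>" and ?q = "poss_sup x \<psi>"
  have pq: "?p \<in> {0..1}" "?q \<in> {0..1}" "max ?p ?q \<in> {0..1}"
    using poss_sup_bounds[OF \<phi>] poss_sup_bounds[OF \<psi>] by auto
  have "Ps_le ?p \<phi> \<in> x" "Ps_le ?q \<psi> \<in> x"
    using Ps_le_iff \<phi> \<psi> pq by auto
  then have "(Ps_le ?p \<phi> \<^bold>\<and> Ps_le ?q \<psi>) \<in> x"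
    using \<phi> \<psi> pq by (subst And_in_x) auto
  moreover have "((Ps_le ?p \<phi> \<^bold>\<and> Ps_le ?q \<psi>) \<^bold>\<longrightarrow> Ps_le (max ?p ?q) (\<phi> \<^bold>\<or> \<psi>)) \<in> x"
    by (intro Ax_in_x Ps_max \<phi> \<psi> pq)
  ultimately have "Ps_le (max ?p ?q) (\<phi> \<^bold>\<or> \<psi>) \<in> x"
    using \<phi> \<psi> pq by (subst (asm) Imp_in_x) auto
  then show "poss_sup x (\<phi> \<^bold>\<or> \<psi>) \<le> max ?p ?q"
    using \<phi> \<psi> pq(3) by (subst (asm) Ps_le_iff) auto
  show "max ?p ?q \<le> poss_sup x (\<phi> \<^bold>\<or> \<psi>)"
    using \<phi> \<psi> by (auto intro!: poss_sup_mono simp: truth_set_Or S_Ing MForm_imp_Form)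
qed

text \<open>Stated for any \<open>\<pi>\<close> compatible with the suprema, which keeps the choice
  of representing formulas out of the argument.\<close>

lemma possibility_measure_canon:
  assumes \<pi>: "\<And>\<phi>. \<phi> \<in> MForm T S \<Longrightarrow> \<pi> (truth_set T D S \<phi>) = poss_sup x \<phi>"
  shows "possibility_measure (canon T D S) (canon_algebra T D S) \<pi>"
  unfolding possibility_measure_def
proof (intro conjI ballI)
  show "algebra (canon T D S) (canon_algebra T D S)"
    by (rule algebra_canon[OF S_Ing])
  show "\<pi> {} = 0"
    using \<pi>[of "\<^bold>\<bottom>"] by (simp add: truth_set_Bot S_Ing poss_sup_Bot)
  show "\<pi> (canon T D S) = 1"
    using \<pi>[of "\<^bold>\<top>"] by (simp add: truth_set_Neg truth_set_Bot S_Ing poss_sup_Top)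
  show "0 \<le> \<pi> U" "\<pi> U \<le> 1" if "U \<in> canon_algebra T D S" for U
    using that \<pi> poss_sup_bounds by (auto simp: canon_algebra_def)
  show "\<pi> (U \<union> V) = max (\<pi> U) (\<pi> V)"
    if UV_in: "U \<in> canon_algebra T D S" "V \<in> canon_algebra T D S" for U V
  proof -
    obtain \<phi> \<psi> where F: "\<phi> \<in> MForm T S" "\<psi> \<in> MForm T S"
      and UV: "U = truth_set T D S \<phi>" "V = truth_set T D S \<psi>"
      using UV_in unfolding canon_algebra_def by blast
    have "U \<union> V = truth_set T D S (\<phi> \<^bold>\<or> \<psi>)"
      using F UV by (simp add: truth_set_Or S_Ing MForm_imp_Form)
    then show ?thesis
      using F by (simp add: \<pi> UV poss_sup_Or)
  qed
qed

end

theorem theorem5p23: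
  fixes T S :: "'m upf" and D :: "'m entailment" and x :: "'m form set"
  assumes "uncertainty_polynomial T"
    and "deduction_system T D"
    and "lindenbaum T D"
    and "PossF S \<in> Ing T"
    and "x \<in> canon T D (PossF S)"
  shows "(\<forall>\<phi>\<in>MForm T S. \<forall>\<psi>\<in>MForm T S.
            truth_set T D S \<phi> = truth_set T D S \<psi> \<longrightarrow> poss_sup x \<phi> = poss_sup x \<psi>) \<and>
         (\<exists>\<pi>. (\<forall>\<phi>\<in>MForm T S. \<pi> (truth_set T D S \<phi>) = poss_sup x \<phi>) \<and>
              possibility_measure (canon T D S) (canon_algebra T D S) \<pi>)"
proof -
  interpret canonical_possibility T D S x
    using assms by (simp add: canonical_possibility_def canonical_possibility_axioms_def canon_def)
  \<comment> \<open>\<open>inv_into\<close> picks some formula representing \<open>U\<close>, and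
    \<open>poss_sup_cong\<close> makes the choice immaterial. Values outside
    \<open>canon_algebra T D S\<close> are arbitrary; \<open>possibility_measure\<close> does not
    constrain them.\<close>
  define \<pi> where "\<pi> U = poss_sup x (inv_into (MForm T S) (truth_set T D S) U)" for U
  have \<pi>: "\<pi> (truth_set T D S \<phi>) = poss_sup x \<phi>" if "\<phi> \<in> MForm T S" for \<phi>
    unfolding \<pi>_def using that by (intro poss_sup_cong inv_into_into f_inv_into_f imageI)
  have "possibility_measure (canon T D S) (canon_algebra T D S) \<pi>"
    by (rule possibility_measure_canon) (rule \<pi>)
  with \<pi> show ?thesis
    by (intro conjI exI[of _ \<pi>] ballI impI poss_sup_cong)
qed

end
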